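(* Let $n,d\in\mathbb{N}$ with $d\in\{1,\ldots,n\}$ and let $(X,\|\cdot\|_X)$ be a complex Banach space. For every $p\in[1,\infty]$ and every function $f:\{-1,1\}^n\to X$ of degree at most $d$, we have $$\forall\, t\geq 0,\qquad \|e^{-t\Delta}f\|_{L_p(\{-1,1\}^n;X)}\geq \frac{1}{T_d(e^t)}\,\|f\|_{L_p(\{-1,1\}^n;X)},$$ where $T_d$ is the $d$-th Chebyshev polynomial of the first kind.
   Context: $\mathbb{N}=\{1,2,\ldots\}$. For $p\in[1,\infty)$, $\|f\|_{L_p(\{-1,1\}^n;X)}=\big(2^{-n}\sum_{\varepsilon\in\{-1,1\}^n}\|f(\varepsilon)\|_X^p\big)^{1/p}$, and $\|f\|_{L_\infty(\{-1,1\}^n;X)}=\max_{\varepsilon}\|f(\varepsilon)\|_X$. For $A\subseteq\{1,\ldots,n\}$, the Walsh function is $w_A(\varepsilon)=\prod_{i\in A}\varepsilon_i$. Every $f:\{-1,1\}^n\to X$ has the expansion $f=\sum_{A}\widehat f(A)w_A$ with $\widehat f(A)=2^{-n}\sum_{\delta\in\{-1,1\}^n}f(\delta)w_A(\delta)\in X$. The discrete heat semigroup is $e^{-t\Delta}f=\sum_A e^{-t|A|}\widehat f(A)w_A$. A function $f$ has degree at most $d$ if $\widehat f(A)=0$ whenever $|A|>d$. $T_d$ is the unique polynomial of degree $d$ with $T_d(\cos\theta)=\cos(d\theta)$ for all real $\theta$. *)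

theory Defs
  imports "HOL-Analysis.Analysis" "HOL-Computational_Algebra.Polynomial"
begin

text \<open>
  Complex Banach spaces. The real scalar multiplication inherited from \<^class>\<open>banach\<close> is
  required to be the restriction of the complex one; norm, metric and completeness are shared.
\<close>

class complex_banach = banach +
  fixes scaleC :: "complex \<Rightarrow> 'a \<Rightarrow> 'a"  (infixr \<open>*\<^sub>C\<close> 75)
  assumes scaleC_add_right: "a *\<^sub>C (x + y) = a *\<^sub>C x + a *\<^sub>C y"
    and scaleC_add_left: "(a + b) *\<^sub>C x = a *\<^sub>C x + b *\<^sub>C x"
    and scaleC_scaleC: "a *\<^sub>C b *\<^sub>C x = (a * b) *\<^sub>C x"
    and scaleC_one: "1 *\<^sub>C x = x"
    and scaleC_of_real: "complex_of_real r *\<^sub>C x = r *\<^sub>R x"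
    and norm_scaleC: "norm (a *\<^sub>C x) = cmod a * norm x"

instantiation complex :: complex_banach
begin

definition scaleC_complex :: "complex \<Rightarrow> complex \<Rightarrow> complex" where
  "scaleC_complex a x = a * x"

instance
  by standard (simp_all add: scaleC_complex_def algebra_simps norm_mult scaleR_conv_of_real)

end

text \<open>
  Points of the cube are functions on \<open>{1..n}\<close>, extended by \<^const>\<open>undefined\<close> outside;
  a function on the cube is a HOL function of which only the values on \<open>cube n\<close> matter.
\<close>

definition cube :: "nat \<Rightarrow> (nat \<Rightarrow> real) set" where
  "cube n = {1..n} \<rightarrow>\<^sub>E {-1, 1}"

definition Lp_norm :: "nat \<Rightarrow> ennreal \<Rightarrow> ((nat \<Rightarrow> real) \<Rightarrow> 'a::real_normed_vector) \<Rightarrow> real" where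
  "Lp_norm n p f =
    (if p = \<infinity> then Max ((\<lambda>\<epsilon>. norm (f \<epsilon>)) ` cube n)
     else ((\<Sum>\<epsilon>\<in>cube n. norm (f \<epsilon>) powr enn2real p) / 2 ^ n) powr (1 / enn2real p))"

definition walsh :: "nat set \<Rightarrow> (nat \<Rightarrow> real) \<Rightarrow> real" where
  "walsh A \<epsilon> = (\<Prod>i\<in>A. \<epsilon> i)"

definition walsh_coeff :: "nat \<Rightarrow> ((nat \<Rightarrow> real) \<Rightarrow> 'a::real_vector) \<Rightarrow> nat set \<Rightarrow> 'a" where
  "walsh_coeff n f A = (1 / 2 ^ n) *\<^sub>R (\<Sum>\<delta>\<in>cube n. walsh A \<delta> *\<^sub>R f \<delta>)"

definition heat :: "nat \<Rightarrow> real \<Rightarrow> ((nat \<Rightarrow> real) \<Rightarrow> 'a::real_vector) \<Rightarrow> (nat \<Rightarrow> real) \<Rightarrow> 'a" where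
  "heat n t f \<epsilon> =
    (\<Sum>A\<in>Pow {1..n}. (exp (- t * real (card A)) * walsh A \<epsilon>) *\<^sub>R walsh_coeff n f A)"

definition cube_degree_le :: "nat \<Rightarrow> nat \<Rightarrow> ((nat \<Rightarrow> real) \<Rightarrow> 'a::real_vector) \<Rightarrow> bool" where
  "cube_degree_le n d f \<longleftrightarrow> (\<forall>A\<subseteq>{1..n}. card A > d \<longrightarrow> walsh_coeff n f A = 0)"

definition chebyshev_T :: "nat \<Rightarrow> real poly" where
  "chebyshev_T d = (THE P. degree P = d \<and> (\<forall>\<theta>. poly P (cos \<theta>) = cos (real d * \<theta>)))"

lemma chebyshev_T_exists:
  "\<exists>P :: real poly. degree P = d \<and> (\<forall>\<theta>. poly P (cos \<theta>) = cos (real d * \<theta>))"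
proof -
  have "\<exists>P Q :: real poly. degree P = d \<and> (\<forall>\<theta>. poly P (cos \<theta>) = cos (real d * \<theta>)) \<and>
          degree Q = Suc d \<and> (\<forall>\<theta>. poly Q (cos \<theta>) = cos (real (Suc d) * \<theta>))"
  proof (induction d)
    case 0
    show ?case by (rule exI[of _ 1], rule exI[of _ "[:0, 1:]"]) simp
  next
    case (Suc d)
    then obtain P Q :: "real poly"
      where P: "degree P = d" "\<And>\<theta>. poly P (cos \<theta>) = cos (real d * \<theta>)"
        and Q: "degree Q = Suc d" "\<And>\<theta>. poly Q (cos \<theta>) = cos (real (Suc d) * \<theta>)"
      by blast
    define R where "R = [:0, 2:] * Q + (- P)"
    have "Q \<noteq> 0" using Q(1) by auto
    then have deg: "degree ([:0, 2:] * Q) = Suc (Suc d)"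
      using Q(1) by (subst degree_mult_eq) auto
    have "degree R = Suc (Suc d)"
      unfolding R_def using deg P(1) by (subst degree_add_eq_left) auto
    moreover have "poly R (cos \<theta>) = cos (real (Suc (Suc d)) * \<theta>)" for \<theta>
    proof -
      have "cos (real (Suc (Suc d)) * \<theta>) = cos (real (Suc d) * \<theta> + \<theta>)"
        by (simp add: algebra_simps)
      moreover have "cos (real d * \<theta>) = cos (real (Suc d) * \<theta> - \<theta>)"
        by (simp add: algebra_simps)
      ultimately show ?thesis
        unfolding R_def by (simp add: P(2) Q(2) cos_add cos_diff del: of_nat_Suc)
    qed
    ultimately show ?case using Q by blast
  qed
  then show ?thesis by blast
qed

lemma chebyshev_T_unique:
  fixes P Q :: "real poly"
  assumes "\<And>\<theta>. poly P (cos \<theta>) = cos (real d * \<theta>)" "\<And>\<theta>. poly Q (cos \<theta>) = cos (real d * \<theta>)"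
  shows "P = Q"
proof (rule ccontr)
  assume "P \<noteq> Q"
  then have "finite {x. poly (P - Q) x = 0}" by (intro poly_roots_finite) simp
  moreover have "{-1..1} \<subseteq> {x. poly (P - Q) x = 0}"
  proof
    fix x :: real assume "x \<in> {-1..1}"
    then have "x = cos (arccos x)" by simp
    then show "x \<in> {x. poly (P - Q) x = 0}" using assms[of "arccos x"] by simp
  qed
  ultimately have "finite {-1..1::real}" by (rule rev_finite_subset)
  then show False by (simp add: infinite_Icc)
qed

lemma chebyshev_T:
  "degree (chebyshev_T d) = d" "poly (chebyshev_T d) (cos \<theta>) = cos (real d * \<theta>)"
proof -
  have "\<exists>!P :: real poly. degree P = d \<and> (\<forall>\<theta>. poly P (cos \<theta>) = cos (real d * \<theta>))"
    using chebyshev_T_exists chebyshev_T_unique by (metis (no_types, lifting))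
  from theI'[OF this] show "degree (chebyshev_T d) = d"
    "poly (chebyshev_T d) (cos \<theta>) = cos (real d * \<theta>)"
    unfolding chebyshev_T_def by blast+
qed

end

theory Submission
  imports Defs
begin

text \<open>
  Write \<open>N\<^sub>s\<close> for the noise operator \<open>w\<^sub>A \<mapsto> s\<^bsup>|A|\<^esup> w\<^sub>A\<close>, so that the heat semigroup is
  \<open>N\<^sub>s\<close> at \<open>s = exp (- t)\<close>. If \<open>f\<close> has degree at most \<open>d\<close> and \<open>g\<close> is its evolution up to time
  \<open>t\<close>, then \<open>s \<mapsto> N\<^sub>s g\<close> is a polynomial in \<open>s\<close> of degree at most \<open>d\<close> with vector coefficients,
  and its value at \<open>y = exp t\<close> is \<open>f\<close>. For \<open>\<bar>s\<bar> \<le> 1\<close> the operator \<open>N\<^sub>s\<close> is an average, hence a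
  contraction on every \<open>L\<^sub>p\<close>. The problem is therefore to bound a polynomial outside \<open>[-1, 1]\<close> by
  its size on \<open>[-1, 1]\<close>, which is the extremal property of the Chebyshev polynomials.

  That property is needed for vector-valued polynomials, and Lagrange interpolation at the extremal
  points \<open>x\<^sub>j = cos (j \<pi> / d)\<close> of \<open>T\<^sub>d\<close> yields it without passing to linear functionals. It gives
  \<open>f = (\<Sum>j\<le>d. c\<^sub>j N\<^sub>s g)\<close> with \<open>s = x\<^sub>j\<close> in the \<open>j\<close>-th term (\<open>heat_reversal\<close>), where
  \<open>c\<^sub>j\<close> is the value at \<open>y\<close> of the \<open>j\<close>-th Lagrange basis polynomial. For \<open>y \<ge> 1\<close> the sign of
  \<open>c\<^sub>j\<close>, unless it vanishes, is \<open>(-1)\<^sup>j\<close>, which is also the value of \<open>T\<^sub>d\<close> at \<open>x\<^sub>j\<close>; interpolating \<open>T\<^sub>d\<close> itself then shows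
  that \<open>\<Sum>j\<le>d. \<bar>c\<^sub>j\<bar>\<close> is exactly \<open>T\<^sub>d y\<close> (\<open>chebyshev_extrapolation\<close>).

  Instead of combining the triangle inequality in \<open>L\<^sub>p\<close> with contractivity, both are obtained at
  once: pointwise, \<open>norm f\<close> is dominated by the nonnegative kernel formed from the \<open>\<bar>c\<^sub>j\<bar>\<close>
  and the kernels of the averages, applied to \<open>norm g\<close>. All its row and column sums equal \<open>T\<^sub>d y\<close>, and
  Jensen's inequality bounds such a kernel on \<open>L\<^sub>p\<close> (\<open>Lp_norm_kernel_le\<close>).
\<close>

section \<open>Extrapolation from the Chebyshev extremal points\<close>

lemma lagrange_interpolation:
  fixes x :: "nat \<Rightarrow> 'a::field"
  assumes inj: "inj_on x {..d}" and deg: "degree Q \<le> d"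
  shows "poly Q y = (\<Sum>j\<le>d. (\<Prod>i\<in>{..d} - {j}. (y - x i) / (x j - x i)) * poly Q (x j))"
proof -
  define L where "L j = (\<Prod>i\<in>{..d} - {j}. smult (inverse (x j - x i)) [:- x i, 1:])" for j
  define R where "R = (\<Sum>j\<le>d. smult (poly Q (x j)) (L j))"
  have poly_L: "poly (L j) z = (\<Prod>i\<in>{..d} - {j}. (z - x i) / (x j - x i))" for j z
    unfolding L_def poly_prod by (intro prod.cong) (simp_all add: diff_divide_distrib divide_inverse algebra_simps)
  have L_node: "poly (L j) (x k) = (if k = j then 1 else 0)" if "j \<le> d" "k \<le> d" for j k
  proof (cases "k = j")
    case True
    have "(x j - x i) / (x j - x i) = 1" if "i \<in> {..d} - {j}" for i
      using inj_onD[OF inj, of j i] that \<open>j \<le> d\<close> by auto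
    then show ?thesis using True by (simp add: poly_L)
  next
    case False
    then show ?thesis using that by (auto simp: poly_L intro!: bexI[of _ k])
  qed
  have deg_L: "degree (L j) \<le> d" if "j \<le> d" for j
  proof -
    have "degree (L j) \<le> (\<Sum>i\<in>{..d} - {j}. degree (smult (inverse (x j - x i)) [:- x i, 1:]))"
      unfolding L_def by (intro degree_prod_sum_le[unfolded o_def]) auto
    also have "\<dots> \<le> (\<Sum>i\<in>{..d} - {j}. 1)"
      by (intro sum_mono) simp
    also have "\<dots> = d" using that by simp
    finally show ?thesis .
  qed
  have "Q = R"
  proof (rule poly_eqI_degree[of "x ` {..d}"])
    fix z assume "z \<in> x ` {..d}"
    then obtain k where k: "k \<le> d" "z = x k" by auto
    have "poly R z = (\<Sum>j\<le>d. poly Q (x j) * (if k = j then 1 else 0))"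
      unfolding R_def poly_sum k(2) by (intro sum.cong) (use L_node k in auto)
    then show "poly Q z = poly R z" using k by (simp add: if_distrib cong: if_cong)
  next
    show "degree Q < card (x ` {..d})" using inj deg by (simp add: card_image)
    have "degree R \<le> d" unfolding R_def
      by (intro degree_sum_le) (use deg_L in \<open>auto intro: degree_smult_le[THEN order_trans]\<close>)
    then show "degree R < card (x ` {..d})" using inj by (simp add: card_image)
  qed
  then have "poly Q y = poly R y" by simp
  then show ?thesis by (simp add: R_def poly_sum poly_L mult.commute)
qed

text \<open>
  The nodes are the extremal points of \<open>T\<^sub>d\<close> and the weights are the Lagrange basis polynomials at
  \<open>y\<close>. The total weight is computed by interpolating \<open>T\<^sub>d\<close>: its values \<open>(-1)\<^sup>j\<close> at the nodes
  cancel the alternating signs of the weights. For \<open>d = 0\<close> the only node is \<open>cos 0 = 1\<close>, thanks to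
  the convention \<open>0 / 0 = 0\<close>.
\<close>

lemma chebyshev_extrapolation:
  fixes y :: real
  assumes y: "1 \<le> y"
  obtains c x :: "nat \<Rightarrow> real"
  where "\<And>j. j \<le> d \<Longrightarrow> \<bar>x j\<bar> \<le> 1"
    and "(\<Sum>j\<le>d. \<bar>c j\<bar>) = poly (chebyshev_T d) y"
    and "\<And>k. k \<le> d \<Longrightarrow> y ^ k = (\<Sum>j\<le>d. c j * x j ^ k)"
proof -
  define x where "x j = cos (real j * pi / real d)" for j
  define c where "c j = (\<Prod>i\<in>{..d} - {j}. (y - x i) / (x j - x i))" for j
  have x_less: "x j < x i" if "i < j" "j \<le> d" for i j
    unfolding x_def using that by (intro cos_monotone_0_pi) (auto simp: field_simps)
  have inj: "inj_on x {..d}"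
    by (rule linorder_inj_onI') (use x_less in fastforce)
  have interp: "poly Q y = (\<Sum>j\<le>d. c j * poly Q (x j))" if "degree Q \<le> d" for Q
    unfolding c_def by (rule lagrange_interpolation[OF inj that])
  have T_node: "poly (chebyshev_T d) (x j) = (-1) ^ j" if "j \<le> d" for j
  proof (cases "d = 0")
    case True
    then show ?thesis using chebyshev_T(2)[of d 0] that by (simp add: x_def)
  next
    case False
    then show ?thesis
      using chebyshev_T(2)[of d "real j * pi / real d"]
      by (simp add: x_def)
  qed
  have sign: "c j * (-1) ^ j = \<bar>c j\<bar>" if j: "j \<le> d" for j
  proof -
    \<comment> \<open>Since \<open>y\<close> is to the right of every node, a factor of \<open>c j\<close> is negative only if its
      node is to the right of \<open>x j\<close>; there are exactly \<open>j\<close> such nodes.\<close>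
    have "({..d} - {j}) \<inter> {i. i < j} = {..<j}" using j by auto
    then have "(-1) ^ j = (\<Prod>i\<in>{..d} - {j}. if i < j then -1 else 1 :: real)"
      by (simp add: prod.If_cases)
    then have "c j * (-1) ^ j =
        (\<Prod>i\<in>{..d} - {j}. (y - x i) / (x j - x i) * (if i < j then -1 else 1))"
      by (simp only: c_def prod.distrib)
    also have "\<dots> \<ge> 0"
    proof (intro prod_nonneg ballI)
      fix i assume i: "i \<in> {..d} - {j}"
      have "x i \<le> y" unfolding x_def using y cos_le_one order_trans by blast
      then show "0 \<le> (y - x i) / (x j - x i) * (if i < j then -1 else 1)"
        using x_less[of i j] x_less[of j i] i j
        by (cases "i < j") (auto intro: divide_nonneg_neg divide_nonneg_pos)
    qed
    finally have "c j * (-1) ^ j = \<bar>c j * (-1) ^ j\<bar>" by simp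
    then show ?thesis by (simp add: abs_mult)
  qed
  show thesis
  proof
    show "\<bar>x j\<bar> \<le> 1" for j by (simp add: x_def)
    show "(\<Sum>j\<le>d. \<bar>c j\<bar>) = poly (chebyshev_T d) y"
      using interp[of "chebyshev_T d"] by (simp add: chebyshev_T(1) T_node sign)
    show "y ^ k = (\<Sum>j\<le>d. c j * x j ^ k)" if "k \<le> d" for k
      using interp[of "monom 1 k"] that by (simp add: degree_monom_eq poly_monom)
  qed
qed

section \<open>The noise operators and their Riesz kernels\<close>

lemma finite_cube [simp]: "finite (cube n)"
  by (simp add: cube_def finite_PiE)

lemma cube_nonempty [simp]: "cube n \<noteq> {}"
  by (simp add: cube_def PiE_eq_empty_iff)

definition noise :: "nat \<Rightarrow> real \<Rightarrow> ((nat \<Rightarrow> real) \<Rightarrow> 'a::real_vector) \<Rightarrow> (nat \<Rightarrow> real) \<Rightarrow> 'a" where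
  "noise n s f \<epsilon> = (\<Sum>A\<in>Pow {1..n}. (s ^ card A * walsh A \<epsilon>) *\<^sub>R walsh_coeff n f A)"

text \<open>
  The integral kernel of the noise operator, normalised by the factor \<open>2\<^sup>-\<^sup>n\<close>, so that it is a
  transition probability of the cube when \<open>\<bar>s\<bar> \<le> 1\<close>. The product form makes every
  sum over the cube factor over the coordinates.
\<close>

definition riesz_kernel :: "nat \<Rightarrow> real \<Rightarrow> (nat \<Rightarrow> real) \<Rightarrow> (nat \<Rightarrow> real) \<Rightarrow> real" where
  "riesz_kernel n s \<epsilon> \<delta> = (\<Prod>i\<in>{1..n}. (1 + s * \<epsilon> i * \<delta> i) / 2)"

lemma heat_eq_noise: "heat n t f = noise n (exp (- t)) f"
  by (rule ext) (simp add: heat_def noise_def exp_of_nat_mult [symmetric] mult.commute)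

lemma riesz_kernel_commute: "riesz_kernel n s \<epsilon> \<delta> = riesz_kernel n s \<delta> \<epsilon>"
  by (simp add: riesz_kernel_def mult_ac)

text \<open>Multiplying out the product, one chooses the set \<open>A\<close> of coordinates that contribute
  \<open>s * \<epsilon> i * \<delta> i\<close> rather than \<open>1\<close>.\<close>

lemma riesz_kernel_walsh:
  "riesz_kernel n s \<epsilon> \<delta> = (\<Sum>A\<in>Pow {1..n}. s ^ card A * walsh A \<epsilon> * walsh A \<delta>) / 2 ^ n"
proof -
  have "(\<Prod>i\<in>{1..n}. s * \<epsilon> i * \<delta> i + 1) = (\<Sum>A\<in>Pow {1..n}. s ^ card A * walsh A \<epsilon> * walsh A \<delta>)"
    by (subst prod_add) (simp_all add: walsh_def prod.distrib)
  then show ?thesis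
    by (simp add: riesz_kernel_def prod_dividef add.commute)
qed

lemma noise_eq_kernel_sum: "noise n s f \<epsilon> = (\<Sum>\<delta>\<in>cube n. riesz_kernel n s \<epsilon> \<delta> *\<^sub>R f \<delta>)"
proof -
  have "noise n s f \<epsilon> =
      (\<Sum>A\<in>Pow {1..n}. \<Sum>\<delta>\<in>cube n. (s ^ card A * walsh A \<epsilon> * walsh A \<delta> / 2 ^ n) *\<^sub>R f \<delta>)"
    by (simp add: noise_def walsh_coeff_def scaleR_sum_right mult_ac)
  also have "\<dots> = (\<Sum>\<delta>\<in>cube n. riesz_kernel n s \<epsilon> \<delta> *\<^sub>R f \<delta>)"
    by (subst sum.swap) (simp add: riesz_kernel_walsh sum_divide_distrib flip: scaleR_sum_left)
  finally show ?thesis .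
qed

lemma sum_cube_prod:
  fixes h :: "nat \<Rightarrow> real \<Rightarrow> real"
  shows "(\<Sum>\<delta>\<in>cube n. \<Prod>i\<in>{1..n}. h i (\<delta> i)) = (\<Prod>i\<in>{1..n}. h i (-1) + h i 1)"
  unfolding cube_def by (subst prod_sum_PiE [symmetric]) auto

lemma riesz_kernel_sum: "(\<Sum>\<delta>\<in>cube n. riesz_kernel n s \<epsilon> \<delta>) = 1"
  unfolding riesz_kernel_def using sum_cube_prod[of "\<lambda>i b. (1 + s * \<epsilon> i * b) / 2" n]
  by (simp add: field_simps)

text \<open>In each coordinate, the terms linear in \<open>\<delta> i\<close> cancel in the sum over the two signs. This
  is the semigroup law of the noise operators at the level of kernels.\<close>

lemma riesz_kernel_compose:
  "(\<Sum>\<delta>\<in>cube n. riesz_kernel n s \<epsilon> \<delta> * riesz_kernel n r \<delta> \<eta>) = riesz_kernel n (s * r) \<epsilon> \<eta>"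
proof -
  have "(\<Sum>\<delta>\<in>cube n. riesz_kernel n s \<epsilon> \<delta> * riesz_kernel n r \<delta> \<eta>) =
      (\<Sum>\<delta>\<in>cube n. \<Prod>i\<in>{1..n}. (1 + s * \<epsilon> i * \<delta> i) / 2 * ((1 + r * \<delta> i * \<eta> i) / 2))"
    by (simp only: riesz_kernel_def prod.distrib)
  also have "\<dots> = riesz_kernel n (s * r) \<epsilon> \<eta>"
    unfolding riesz_kernel_def sum_cube_prod[of "\<lambda>i b. (1 + s * \<epsilon> i * b) / 2 * ((1 + r * b * \<eta> i) / 2)"]
    by (intro prod.cong) (simp_all add: field_simps)
  finally show ?thesis .
qed

lemma noise_noise: "noise n s (noise n r f) \<epsilon> = noise n (s * r) f \<epsilon>"
proof -
  have "noise n s (noise n r f) \<epsilon> =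
      (\<Sum>\<delta>\<in>cube n. \<Sum>\<eta>\<in>cube n. (riesz_kernel n s \<epsilon> \<delta> * riesz_kernel n r \<delta> \<eta>) *\<^sub>R f \<eta>)"
    by (simp add: noise_eq_kernel_sum scaleR_sum_right)
  also have "\<dots> = noise n (s * r) f \<epsilon>"
    by (subst sum.swap)
      (simp add: noise_eq_kernel_sum riesz_kernel_compose flip: scaleR_sum_left)
  finally show ?thesis .
qed

text \<open>At \<open>s = 1\<close> a factor vanishes wherever the two points differ. This is the completeness of the
  Walsh system: it gives the Walsh expansion of a function in \<open>noise_one\<close>.\<close>

lemma riesz_kernel_one:
  assumes "\<epsilon> \<in> cube n" "\<delta> \<in> cube n"
  shows "riesz_kernel n 1 \<epsilon> \<delta> = (if \<epsilon> = \<delta> then 1 else 0)"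
proof (cases "\<epsilon> = \<delta>")
  case True
  have "(1 + \<delta> i * \<delta> i) / 2 = 1" if "i \<in> {1..n}" for i
    using PiE_mem[OF assms(2)[unfolded cube_def] that] by auto
  then show ?thesis using True by (simp add: riesz_kernel_def)
next
  case False
  then obtain i where i: "i \<in> {1..n}" "\<epsilon> i \<noteq> \<delta> i"
    using assms PiE_ext unfolding cube_def by metis
  then have "1 + \<epsilon> i * \<delta> i = 0"
    using PiE_mem[OF assms(1)[unfolded cube_def] i(1)] PiE_mem[OF assms(2)[unfolded cube_def] i(1)]
    by auto
  then have "riesz_kernel n 1 \<epsilon> \<delta> = 0"
    unfolding riesz_kernel_def using i(1) by (intro prod_zero) auto
  then show ?thesis using False by simp
qed

lemma noise_one: "\<epsilon> \<in> cube n \<Longrightarrow> noise n 1 f \<epsilon> = f \<epsilon>"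
  by (simp add: noise_eq_kernel_sum riesz_kernel_one if_distrib[of "\<lambda>c. c *\<^sub>R _"] cong: if_cong)

lemma riesz_kernel_nonneg:
  assumes "\<bar>s\<bar> \<le> 1" "\<epsilon> \<in> cube n" "\<delta> \<in> cube n"
  shows "0 \<le> riesz_kernel n s \<epsilon> \<delta>"
  unfolding riesz_kernel_def
proof (intro prod_nonneg ballI)
  fix i assume "i \<in> {1..n}"
  then have "\<epsilon> i \<in> {-1, 1}" "\<delta> i \<in> {-1, 1}"
    using assms(2,3) PiE_mem unfolding cube_def by fast+
  then show "0 \<le> (1 + s * \<epsilon> i * \<delta> i) / 2" using assms(1) by auto
qed

section \<open>Kernels with constant marginals are bounded on \<open>L\<^sub>p\<close>\<close>

text \<open>Including the endpoint \<open>0\<close> matters for Jensen's inequality below, because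
  the norms to which it is applied may vanish.\<close>

lemma convex_on_powr_atLeast_0:
  fixes p :: real
  assumes p: "1 \<le> p"
  shows "convex_on {0..} (\<lambda>x. x powr p)"
proof (rule convex_on_linorderI)
  fix t x y :: real
  assume t: "0 < t" "t < 1" and xy: "x \<in> {0..}" "y \<in> {0..}" "x < y"
  show "((1 - t) *\<^sub>R x + t *\<^sub>R y) powr p \<le> (1 - t) * x powr p + t * y powr p"
  proof (cases "x = 0")
    case True
    have "t powr p \<le> t" using powr_mono'[of 1 p t] p t by simp
    then show ?thesis using True by (simp add: powr_mult mult_right_mono)
  next
    case False
    then show ?thesis using convex_onD[OF powr_convex[OF p], of t x y] t xy by auto
  qed
qed simp

text \<open>
  A form of Schur's test. Dividing a row of the kernel by \<open>C\<close> gives a probability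
  distribution, so Jensen's inequality moves the power \<open>p\<close> inside the sum; after summation over
  \<open>\<epsilon>\<close> the column sums account for the remaining factor.
\<close>

lemma Lp_norm_kernel_le:
  fixes f :: "(nat \<Rightarrow> real) \<Rightarrow> 'a::real_normed_vector" and g :: "(nat \<Rightarrow> real) \<Rightarrow> 'b::real_normed_vector"
  assumes p: "1 \<le> p" and C: "0 < C"
    and M: "\<And>\<epsilon> \<delta>. \<epsilon> \<in> cube n \<Longrightarrow> \<delta> \<in> cube n \<Longrightarrow> 0 \<le> M \<epsilon> \<delta>"
    and rows: "\<And>\<epsilon>. \<epsilon> \<in> cube n \<Longrightarrow> (\<Sum>\<delta>\<in>cube n. M \<epsilon> \<delta>) = C"
    and cols: "\<And>\<delta>. \<delta> \<in> cube n \<Longrightarrow> (\<Sum>\<epsilon>\<in>cube n. M \<epsilon> \<delta>) = C"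
    and le: "\<And>\<epsilon>. \<epsilon> \<in> cube n \<Longrightarrow> norm (f \<epsilon>) \<le> (\<Sum>\<delta>\<in>cube n. M \<epsilon> \<delta> * norm (g \<delta>))"
  shows "Lp_norm n p f \<le> C * Lp_norm n p g"
proof (cases "p = \<infinity>")
  case True
  have "norm (f \<epsilon>) \<le> C * Max ((\<lambda>\<delta>. norm (g \<delta>)) ` cube n)" if \<epsilon>: "\<epsilon> \<in> cube n" for \<epsilon>
  proof -
    have "norm (f \<epsilon>) \<le> (\<Sum>\<delta>\<in>cube n. M \<epsilon> \<delta> * norm (g \<delta>))" by (rule le[OF \<epsilon>])
    also have "\<dots> \<le> (\<Sum>\<delta>\<in>cube n. M \<epsilon> \<delta> * Max ((\<lambda>\<delta>. norm (g \<delta>)) ` cube n))"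
      by (intro sum_mono mult_left_mono M \<epsilon>) auto
    also have "\<dots> = C * Max ((\<lambda>\<delta>. norm (g \<delta>)) ` cube n)"
      by (simp add: rows[OF \<epsilon>] flip: sum_distrib_right)
    finally show ?thesis .
  qed
  then show ?thesis using True by (simp add: Lp_norm_def)
next
  case False
  define q where "q = enn2real p"
  have q: "1 \<le> q"
    using enn2real_mono[of 1 p] p False by (simp add: q_def top.not_eq_extremum)
  have "norm (f \<epsilon>) powr q \<le> C powr q * (\<Sum>\<delta>\<in>cube n. M \<epsilon> \<delta> / C * norm (g \<delta>) powr q)"
    if \<epsilon>: "\<epsilon> \<in> cube n" for \<epsilon>
  proof -
    have "norm (f \<epsilon>) powr q \<le> (\<Sum>\<delta>\<in>cube n. M \<epsilon> \<delta> * norm (g \<delta>)) powr q"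
      using le[OF \<epsilon>] q by (intro powr_mono2) auto
    also have "\<dots> = C powr q * (\<Sum>\<delta>\<in>cube n. (M \<epsilon> \<delta> / C) *\<^sub>R norm (g \<delta>)) powr q"
      using C by (simp add: sum_divide_distrib[symmetric] flip: powr_mult)
    also have "\<dots> \<le> C powr q * (\<Sum>\<delta>\<in>cube n. M \<epsilon> \<delta> / C * norm (g \<delta>) powr q)"
      using C M[OF \<epsilon>] rows[OF \<epsilon>]
      by (intro mult_left_mono convex_on_sum[OF _ _ convex_on_powr_atLeast_0[OF q]])
        (simp_all flip: sum_divide_distrib)
    finally show ?thesis .
  qed
  then have "(\<Sum>\<epsilon>\<in>cube n. norm (f \<epsilon>) powr q) \<le>
      (\<Sum>\<epsilon>\<in>cube n. C powr q * (\<Sum>\<delta>\<in>cube n. M \<epsilon> \<delta> / C * norm (g \<delta>) powr q))"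
    by (rule sum_mono)
  also have "\<dots> = C powr q * (\<Sum>\<delta>\<in>cube n. (\<Sum>\<epsilon>\<in>cube n. M \<epsilon> \<delta>) / C * norm (g \<delta>) powr q)"
    unfolding sum_distrib_left[symmetric]
    by (subst sum.swap) (simp add: sum_distrib_right sum_divide_distrib)
  also have "\<dots> = C powr q * (\<Sum>\<delta>\<in>cube n. norm (g \<delta>) powr q)"
    using C by (simp add: cols)
  finally have "((\<Sum>\<epsilon>\<in>cube n. norm (f \<epsilon>) powr q) / 2 ^ n) powr (1 / q) \<le>
      (C powr q * ((\<Sum>\<delta>\<in>cube n. norm (g \<delta>) powr q) / 2 ^ n)) powr (1 / q)"
    using q by (intro powr_mono2) (auto intro!: sum_nonneg divide_nonneg_nonneg divide_right_mono)
  also have "\<dots> = C * ((\<Sum>\<delta>\<in>cube n. norm (g \<delta>) powr q) / 2 ^ n) powr (1 / q)"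
    unfolding powr_mult using C q by (simp add: powr_powr)
  finally show ?thesis using False by (simp add: Lp_norm_def q_def)
qed

section \<open>Reversing the heat flow on low-degree functions\<close>

text \<open>
  The coefficient at \<open>A\<close> has been multiplied by \<open>exp (- t)\<close> to the power \<open>card A\<close>. The inverse
  factor is the monomial of degree \<open>card A \<le> d\<close> at \<open>exp t\<close>, so a rule that extrapolates all these
  monomials recovers every coefficient simultaneously.
\<close>

lemma heat_reversal:
  assumes deg: "cube_degree_le n d f"
    and interp: "\<And>k. k \<le> d \<Longrightarrow> exp t ^ k = (\<Sum>j\<in>J. c j * x j ^ k)"
    and \<epsilon>: "\<epsilon> \<in> cube n"
  shows "f \<epsilon> = (\<Sum>j\<in>J. c j *\<^sub>R noise n (x j) (heat n t f) \<epsilon>)"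
proof -
  have "(\<Sum>j\<in>J. c j *\<^sub>R noise n (x j) (heat n t f) \<epsilon>) =
      (\<Sum>A\<in>Pow {1..n}. ((\<Sum>j\<in>J. c j * x j ^ card A) * exp (- t) ^ card A * walsh A \<epsilon>) *\<^sub>R
        walsh_coeff n f A)"
    unfolding heat_eq_noise noise_noise
    unfolding noise_def scaleR_sum_right
    by (subst sum.swap)
      (simp add: sum_distrib_right power_mult_distrib mult.assoc scaleR_sum_left)
  also have "\<dots> = noise n 1 f \<epsilon>"
    unfolding noise_def
  proof (rule sum.cong[OF refl])
    fix A assume A: "A \<in> Pow {1..n}"
    show "((\<Sum>j\<in>J. c j * x j ^ card A) * exp (- t) ^ card A * walsh A \<epsilon>) *\<^sub>R walsh_coeff n f A =
        (1 ^ card A * walsh A \<epsilon>) *\<^sub>R walsh_coeff n f A"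
    proof (cases "card A \<le> d")
      case True
      then have "(\<Sum>j\<in>J. c j * x j ^ card A) * exp (- t) ^ card A = (exp t * exp (- t)) ^ card A"
        by (simp only: interp power_mult_distrib)
      then show ?thesis by (simp flip: exp_add)
    next
      case False
      then show ?thesis using deg A by (auto simp: cube_degree_le_def)
    qed
  qed
  finally show ?thesis using noise_one[OF \<epsilon>, of f] by simp
qed

theorem theorem1:
  fixes n d :: nat and p :: ennreal and f :: "(nat \<Rightarrow> real) \<Rightarrow> 'a::complex_banach"
  assumes "1 \<le> n" and "d \<in> {1..n}"
    and "1 \<le> p"
    and "cube_degree_le n d f"
  shows "\<forall>t\<ge>0. Lp_norm n p (heat n t f) \<ge> 1 / poly (chebyshev_T d) (exp t) * Lp_norm n p f"
proof (intro allI impI)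
  fix t :: real
  assume "0 \<le> t"
  then obtain c x :: "nat \<Rightarrow> real"
    where x: "\<And>j. j \<le> d \<Longrightarrow> \<bar>x j\<bar> \<le> 1"
      and C: "(\<Sum>j\<le>d. \<bar>c j\<bar>) = poly (chebyshev_T d) (exp t)"
      and interp: "\<And>k. k \<le> d \<Longrightarrow> exp t ^ k = (\<Sum>j\<le>d. c j * x j ^ k)"
    using chebyshev_extrapolation[of "exp t" d] one_le_exp_iff by metis
  define M where "M \<epsilon> \<delta> = (\<Sum>j\<le>d. \<bar>c j\<bar> * riesz_kernel n (x j) \<epsilon> \<delta>)" for \<epsilon> \<delta>
  \<comment> \<open>The rule reproduces constants, so its total weight is at least \<open>1\<close>.\<close>
  have "1 = (\<Sum>j\<le>d. c j)" using interp[of 0] by simp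
  also have "\<dots> \<le> (\<Sum>j\<le>d. \<bar>c j\<bar>)" by (intro sum_mono) simp
  finally have T_pos: "0 < poly (chebyshev_T d) (exp t)" by (simp add: C)
  have "Lp_norm n p f \<le> poly (chebyshev_T d) (exp t) * Lp_norm n p (heat n t f)"
  proof (rule Lp_norm_kernel_le[OF assms(3) T_pos, where M = M])
    fix \<epsilon> assume \<epsilon>: "\<epsilon> \<in> cube n"
    show "0 \<le> M \<epsilon> \<delta>" if "\<delta> \<in> cube n" for \<delta>
      unfolding M_def by (intro sum_nonneg mult_nonneg_nonneg riesz_kernel_nonneg x \<epsilon> that) auto
    show rows: "(\<Sum>\<delta>\<in>cube n. M \<epsilon> \<delta>) = poly (chebyshev_T d) (exp t)"
      unfolding M_def by (subst sum.swap) (simp add: riesz_kernel_sum C flip: sum_distrib_left)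
    then show "(\<Sum>\<delta>\<in>cube n. M \<delta> \<epsilon>) = poly (chebyshev_T d) (exp t)"
      by (simp add: M_def riesz_kernel_commute[of n _ _ \<epsilon>])
    have "norm (f \<epsilon>) \<le> (\<Sum>j\<le>d. norm (c j *\<^sub>R noise n (x j) (heat n t f) \<epsilon>))"
      by (subst heat_reversal[OF assms(4) interp \<epsilon>]) (auto simp del: norm_scaleR intro: norm_sum)
    also have "\<dots> \<le> (\<Sum>j\<le>d. \<bar>c j\<bar> * (\<Sum>\<delta>\<in>cube n. riesz_kernel n (x j) \<epsilon> \<delta> * norm (heat n t f \<delta>)))"
      unfolding noise_eq_kernel_sum norm_scaleR
      by (intro sum_mono mult_left_mono sum_norm_le)
        (use riesz_kernel_nonneg[OF x \<epsilon>] in auto)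
    also have "\<dots> = (\<Sum>\<delta>\<in>cube n. M \<epsilon> \<delta> * norm (heat n t f \<delta>))"
      unfolding M_def sum_distrib_left sum_distrib_right
      by (subst sum.swap) (simp add: mult.assoc)
    finally show "norm (f \<epsilon>) \<le> (\<Sum>\<delta>\<in>cube n. M \<epsilon> \<delta> * norm (heat n t f \<delta>))" .
  qed
  then show "1 / poly (chebyshev_T d) (exp t) * Lp_norm n p f \<le> Lp_norm n p (heat n t f)"
    using T_pos by (simp add: field_simps)
qed

end
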